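(* Let $N\in\mathbb{N}$ and let $\tilde P_N(x)=\sum_{k=0}^{N}(-1)^k\sigma_k x^{N-k}=\prod_{i=1}^N(x-x_i^{(N)})$ (with $\sigma_0=1$) be a monic polynomial of degree $N$ with definite parity, $\tilde P_N(-x)=(-1)^N\tilde P_N(x)$. Let $m_r(N)=\frac1N\sum_{i=1}^N (x_i^{(N)})^r$ and $M=\lfloor N/2\rfloor$. Then: (i) $m_0(N)=1$. (ii) $m_{2l+1}(N)=0$ for all integers $l\ge 0$. (iii) For $N\ge 4$ and every integer $l\ge 1$, $$m_{2l}(N)=\frac{2}{N}(-\sigma_2)^l\sum_{i_1=0}^{\lfloor B_1\rfloor}\cdots\sum_{i_{M-1}=0}^{\lfloor B_{M-1}\rfloor}\left(\prod_{k=1}^{M-1}\frac{(-1)^{(M-k)i_k}}{i_k!}\right)\langle M,l,\{i_j\}\rangle\prod_{p=2}^{M}\left(\frac{\sigma_{2p}}{\sigma_2^{\,p}}\right)^{i_{M-p+1}},$$ where $$B_1=\frac{l}{M},\qquad B_k=\frac{l-\sum_{j=1}^{k-1}(M+1-j)i_j}{M+1-k}\ (2\le k\le M-1),$$ $$\langle M,l,\{i_j\}\rangle=\frac{l\,\bigl(l-1-\sum_{j=1}^{M-1}(M-j)i_j\bigr)!}{\bigl(l-\sum_{j=1}^{M-1}(M+1-j)i_j\bigr)!}.$$ Moreover $$m_{2l}(N)=\frac{2}{N}M(-1)^l\,t_l^{(M)}(\sigma_2,\sigma_4,\dots,\sigma_{2M}),$$ and, if $\sigma_{2M}\ne0$,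 $$m_{2l}(N)=\frac{2}{N}M(-1)^l(\sigma_{2M})^{l/M}\,T_l^{(M-1)}(e_1,\dots,e_{M-1}),\qquad e_k=\frac{\sigma_{2k}}{(\sigma_{2M})^{k/M}}.$$ (iv) For every integer $l\ge1$: $m_{2l}(1)=0$, $m_{2l}(2)=(-\sigma_2)^l$, $m_{2l}(3)=\frac23(-\sigma_2)^l$.
   Context: Zeros are complex and counted with multiplicity; $\sigma_k$ is the $k$-th elementary symmetric function of the zeros. For integers $n\ge1$, $r\ge0$, $t_r^{(n)}(s_1,\dots,s_n)$ denotes the unique polynomial such that $t_r^{(n)}(s_1,\dots,s_n)=\frac1n\sum_{i=1}^n y_i^r$ whenever $s_1,\dots,s_n$ are the elementary symmetric functions of $y_1,\dots,y_n$. The $(n-1)$-variable generalized Chebyshev polynomial of the first kind is $T_r^{(n-1)}(s_1,\dots,s_{n-1})=t_r^{(n)}(s_1,\dots,s_{n-1},1)$. The powers of $\sigma_2$ in the nested-sum formula are to be combined, giving $\sigma_2$ to the nonnegative exponent $l-\sum_{j=1}^{M-1}(M+1-j)i_j$ (with $0^0=1$), so the formula is a polynomial in the $\sigma_{2p}$. Fractional powers $(\sigma_{2M})^{k/M}$ mean $\omega^k$, where $\omega$ is one fixed choice of $M$-th root of $\sigma_{2M}$ (the same throughout). *)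

theory Defs
  imports
    "HOL-Computational_Algebra.Computational_Algebra"
    "HOL-Library.Poly_Mapping"
begin

definition elem_sym :: "nat \<Rightarrow> (nat \<Rightarrow> complex) \<Rightarrow> nat \<Rightarrow> complex" where
  "elem_sym n y k = (\<Sum>A | A \<subseteq> {1..n} \<and> card A = k. \<Prod>i\<in>A. y i)"

definition power_mean :: "nat \<Rightarrow> (nat \<Rightarrow> complex) \<Rightarrow> nat \<Rightarrow> complex" where
  "power_mean n y r = 1 / of_nat n * (\<Sum>i=1..n. y i ^ r)"

text \<open>
  Multivariate polynomials over the complex numbers, in variables indexed by natural numbers:
  a monomial is a finitely supported exponent map, a polynomial is a finitely supported
  coefficient map on monomials.
\<close>

type_synonym cmpoly = "(nat \<Rightarrow>\<^sub>0 nat) \<Rightarrow>\<^sub>0 complex"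

definition mvars :: "cmpoly \<Rightarrow> nat set" where
  "mvars p = (\<Union>m\<in>Poly_Mapping.keys p. Poly_Mapping.keys m)"

definition meval :: "cmpoly \<Rightarrow> (nat \<Rightarrow> complex) \<Rightarrow> complex" where
  "meval p s = (\<Sum>m\<in>Poly_Mapping.keys p. Poly_Mapping.lookup p m *
      (\<Prod>v\<in>Poly_Mapping.keys m. s v ^ Poly_Mapping.lookup m v))"

text \<open>
  \<open>t_poly n r\<close> is $t_r^{(n)}$, a polynomial in the variables $s_1, \dots, s_n$, for $n \ge 1$.
\<close>

definition t_poly :: "nat \<Rightarrow> nat \<Rightarrow> cmpoly" where
  "t_poly n r = (THE p. mvars p \<subseteq> {1..n} \<and>
      (\<forall>y. meval p (elem_sym n y) = power_mean n y r))"

text \<open>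
  \<open>cheb_T m r s\<close> is the $m$-variable generalized Chebyshev polynomial of the first kind
  $T_r^{(m)}(s_1, \dots, s_m)$; only the values $s_1, \dots, s_m$ of \<open>s\<close> matter.
\<close>

definition cheb_T :: "nat \<Rightarrow> nat \<Rightarrow> (nat \<Rightarrow> complex) \<Rightarrow> complex" where
  "cheb_T m r s = meval (t_poly (m + 1) r) (s(m + 1 := 1))"

text \<open>
  \<open>nested_sum n B f\<close> is $\sum_{i_1=0}^{\lfloor B_1\rfloor} \cdots
  \sum_{i_n=0}^{\lfloor B_n\rfloor} f(i_1, \dots, i_n)$, where $B_k$ may depend on
  $i_1, \dots, i_{k-1}$.
\<close>

primrec nested_sum ::
  "nat \<Rightarrow> (nat \<Rightarrow> (nat \<Rightarrow> nat) \<Rightarrow> real) \<Rightarrow> ((nat \<Rightarrow> nat) \<Rightarrow> complex) \<Rightarrow> complex" where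
  "nested_sum 0 B f = f (\<lambda>_. 0)"
| "nested_sum (Suc n) B f =
    nested_sum n B (\<lambda>i. \<Sum>v | int v \<le> \<lfloor>B (Suc n) i\<rfloor>. f (i(Suc n := v)))"

definition B_bound :: "nat \<Rightarrow> nat \<Rightarrow> nat \<Rightarrow> (nat \<Rightarrow> nat) \<Rightarrow> real" where
  "B_bound M l k i =
    (real l - (\<Sum>j=1..k - 1. (real M + 1 - real j) * real (i j))) / (real M + 1 - real k)"

text \<open>
  The natural-number subtractions in \<open>sigma2_exp\<close> and \<open>bracket\<close> do not truncate on the summation
  range \<open>i k \<le> \<lfloor>B_bound M l k i\<rfloor>\<close> ($1 \le k \le M - 1$, $l \ge 1$): there the bound for the last
  index gives $\sum_j (M + 1 - j) i_j \le l$, and hence $\sum_j (M - j) i_j \le l - 1$.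
\<close>

definition sigma2_exp :: "nat \<Rightarrow> nat \<Rightarrow> (nat \<Rightarrow> nat) \<Rightarrow> nat" where
  "sigma2_exp M l i = l - (\<Sum>j=1..M - 1. (M + 1 - j) * i j)"

definition bracket :: "nat \<Rightarrow> nat \<Rightarrow> (nat \<Rightarrow> nat) \<Rightarrow> complex" where
  "bracket M l i =
    of_nat l * fact (l - 1 - (\<Sum>j=1..M - 1. (M - j) * i j))
      / fact (l - (\<Sum>j=1..M - 1. (M + 1 - j) * i j))"

end

theory Submission
  imports Defs
begin

text \<open>
  By parity, $P(x) = x^{N \bmod 2} \prod_{j \le M} (x^2 - y_j)$ where the $k$-th elementary symmetric
  function of the $y_j$ is $(-1)^k \sigma_{2k}$; hence the power sums of odd exponent vanish, and
  that of exponent $2l$ is $2 \sum_j y_j^l$. Evaluating $t_l^{(M)}$ at the points $-y_j$ and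
  $-y_j / \omega$ gives the two polynomial formulas. The nested sum is Waring's formula for
  $\sum_j y_j^l$: writing $\prod_j (1 - y_j X) = 1 - u$, the logarithmic derivative gives
  $\sum_j y_j^l = l \sum_{k \le l} [X^l] u^k / k$, and $u^k$ is expanded by the multinomial theorem.
  Waring's formula also yields the existence of $t_r^{(n)}$; uniqueness holds because every point of
  $\mathbb{C}^n$ is the vector of elementary symmetric functions of some $y_1, \dots, y_n$.
\<close>

section \<open>Exponent vectors of given weight and the multinomial theorem\<close>

text \<open>Forcing the value 0 off \<open>A\<close> makes an exponent vector the same thing as a
  function, so the set is finite for finite \<open>A\<close> and positive weights. Weights 1 index
  the multinomial theorem; weights \<open>w k = k\<close> on \<open>{1..n}\<close> index the
  partitions of \<open>l\<close> into parts of size at most \<open>n\<close>, by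
  multiplicities.\<close>

definition weighted_exps :: "'i set \<Rightarrow> ('i \<Rightarrow> nat) \<Rightarrow> nat \<Rightarrow> ('i \<Rightarrow> nat) set" where
  "weighted_exps A w l = {a. (\<forall>k. k \<notin> A \<longrightarrow> a k = 0) \<and> (\<Sum>k\<in>A. w k * a k) = l}"

lemma sum_weight_upd:
  assumes "x \<notin> A"
  shows "(\<Sum>k\<in>A. w k * (a(x := v)) k) = (\<Sum>k\<in>A. w k * a k :: nat)"
  using assms by (intro sum.cong) auto

lemma weighted_exps_empty: "weighted_exps {} w l = (if l = 0 then {\<lambda>_. 0} else {})"
  by (auto simp: weighted_exps_def)

lemma weighted_exps_insert_upd:
  assumes "finite A" "x \<notin> A" "w x * v \<le> l" "a \<in> weighted_exps A w (l - w x * v)"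
  shows "a(x := v) \<in> weighted_exps (insert x A) w l"
  using assms sum_weight_upd[of x A w a v] by (auto simp: weighted_exps_def simp del: fun_upd_apply)
    (auto simp: fun_upd_def)

lemma weighted_exps_insertD:
  assumes "finite A" "x \<notin> A" "a \<in> weighted_exps (insert x A) w l"
  shows "w x * a x \<le> l" "a(x := 0) \<in> weighted_exps A w (l - w x * a x)"
  using assms sum_weight_upd[of x A w a 0] by (auto simp: weighted_exps_def)

lemma weighted_exps_insert:
  assumes "finite A" "x \<notin> A"
  shows "weighted_exps (insert x A) w l =
    (\<lambda>(v, a). a(x := v)) ` (SIGMA v:{v. w x * v \<le> l}. weighted_exps A w (l - w x * v))" (is "?L = ?R")
proof
  show "?L \<subseteq> ?R"
  proof
    fix a assume "a \<in> ?L"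
    note * = weighted_exps_insertD[OF assms this]
    show "a \<in> ?R"
      by (rule image_eqI[of _ _ "(a x, a(x := 0))"]) (use * in auto)
  qed
  show "?R \<subseteq> ?L"
    using weighted_exps_insert_upd[OF assms] by auto
qed

lemma finite_mult_le:
  assumes "(c::nat) > 0"
  shows "finite {v. c * v \<le> l}"
  by (rule finite_subset[of _ "{..l}"]) (use assms in \<open>auto intro: order_trans[rotated]\<close>)

lemma finite_weighted_exps:
  assumes "finite A" "\<And>k. k \<in> A \<Longrightarrow> w k > 0"
  shows "finite (weighted_exps A w l)"
  using assms
proof (induction A arbitrary: l rule: finite_induct)
  case empty
  then show ?case by (simp add: weighted_exps_empty)
next
  case (insert x A)
  then show ?case
    by (simp add: weighted_exps_insert finite_mult_le)
qed

text \<open>Splitting off the exponent at \<open>x\<close> leaves a vector on \<open>A\<close> of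
  the remaining weight. Positivity of the weights keeps both sums finite.\<close>

lemma sum_weighted_exps_insert:
  assumes "finite A" "x \<notin> A" "\<And>k. k \<in> insert x A \<Longrightarrow> w k > 0"
  shows "(\<Sum>a\<in>weighted_exps (insert x A) w l. g a) =
    (\<Sum>v | w x * v \<le> l. \<Sum>a\<in>weighted_exps A w (l - w x * v). g (a(x := v)))"
proof -
  have zero: "a x = 0" if "a \<in> weighted_exps A w l'" for a l'
    using that assms(2) by (auto simp: weighted_exps_def)
  have "inj_on (\<lambda>(v, a). a(x := v)) (SIGMA v:{v. w x * v \<le> l}. weighted_exps A w (l - w x * v))"
  proof (rule inj_onI, clarify)
    fix v a v' a'
    assume a: "a \<in> weighted_exps A w (l - w x * v)" "a' \<in> weighted_exps A w (l - w x * v')"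
      and eq: "a(x := v) = a'(x := v')"
    have "v = v'" using fun_cong[OF eq, of x] by simp
    moreover have "a k = a' k" for k
      using zero[OF a(1)] zero[OF a(2)] fun_cong[OF eq, of k] by (cases "k = x") auto
    ultimately show "v = v' \<and> a = a'" by auto
  qed
  then have "(\<Sum>a\<in>weighted_exps (insert x A) w l. g a) =
    (\<Sum>(v, a)\<in>(SIGMA v:{v. w x * v \<le> l}. weighted_exps A w (l - w x * v)). g (a(x := v)))"
    unfolding weighted_exps_insert[OF assms(1,2)] by (subst sum.reindex) (auto intro!: sum.cong)
  also have "\<dots> = (\<Sum>v | w x * v \<le> l. \<Sum>a\<in>weighted_exps A w (l - w x * v). g (a(x := v)))"
    using assms by (subst sum.Sigma) (auto intro: finite_mult_le finite_weighted_exps)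
  finally show ?thesis .
qed

text \<open>After division by \<open>fact j\<close> the multinomial coefficient factors into the
  separate \<open>1 / fact (a k)\<close>, so the induction step is the binomial theorem in which
  \<open>1 / fact j\<close> times a binomial coefficient splits into two reciprocal
  factorials.\<close>

lemma fps_multinomial:
  fixes f :: "'i \<Rightarrow> complex fps"
  assumes "finite A"
  shows "fps_const (1 / fact j) * (\<Sum>k\<in>A. f k) ^ j =
    (\<Sum>a\<in>weighted_exps A (\<lambda>_. 1) j. \<Prod>k\<in>A. fps_const (1 / fact (a k)) * f k ^ a k)"
  using assms
proof (induction A arbitrary: j rule: finite_induct)
  case empty
  then show ?case by (auto simp: weighted_exps_empty)
next
  case (insert x A)
  define S where "S = (\<Sum>k\<in>A. f k)"
  have "fps_const (1 / fact j) * (\<Sum>k\<in>insert x A. f k) ^ j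
      = (\<Sum>v\<le>j. fps_const (1 / fact j) * (of_nat (j choose v) * f x ^ v * S ^ (j - v)))"
    using insert by (simp add: S_def[symmetric] binomial_ring sum_distrib_left)
  also have "\<dots> = (\<Sum>v\<le>j. fps_const (1 / fact v) * f x ^ v * (fps_const (1 / fact (j - v)) * S ^ (j - v)))"
  proof (rule sum.cong[OF refl])
    fix v assume "v \<in> {..j}"
    then have "(1 / fact j) * of_nat (j choose v) = (1 / fact v) * (1 / fact (j - v) :: complex)"
      by (simp add: binomial_fact)
    then have *: "fps_const (1 / fact j) * of_nat (j choose v)
        = fps_const (1 / fact v) * fps_const (1 / fact (j - v) :: complex)"
      by (simp add: fps_of_nat[symmetric])
    show "fps_const (1 / fact j) * (of_nat (j choose v) * f x ^ v * S ^ (j - v))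
      = fps_const (1 / fact v) * f x ^ v * (fps_const (1 / fact (j - v)) * S ^ (j - v))"
      using arg_cong[OF *, of "\<lambda>c. c * (f x ^ v * S ^ (j - v))"] by (simp only: ac_simps)
  qed
  also have "\<dots> = (\<Sum>v\<le>j. \<Sum>a\<in>weighted_exps A (\<lambda>_. 1) (j - v).
      fps_const (1 / fact v) * f x ^ v * (\<Prod>k\<in>A. fps_const (1 / fact (a k)) * f k ^ a k))"
    unfolding S_def insert.IH by (simp only: sum_distrib_left)
  also have "\<dots> = (\<Sum>v\<le>j. \<Sum>a\<in>weighted_exps A (\<lambda>_. 1) (j - v).
      \<Prod>k\<in>insert x A. fps_const (1 / fact ((a(x := v)) k)) * f k ^ (a(x := v)) k)"
  proof (intro sum.cong refl)
    fix v and a :: "'i \<Rightarrow> nat"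
    have "(\<Prod>k\<in>A. fps_const (1 / fact ((a(x := v)) k)) * f k ^ (a(x := v)) k)
        = (\<Prod>k\<in>A. fps_const (1 / fact (a k)) * f k ^ a k)"
      using insert.hyps by (intro prod.cong) auto
    then show "fps_const (1 / fact v) * f x ^ v * (\<Prod>k\<in>A. fps_const (1 / fact (a k)) * f k ^ a k)
       = (\<Prod>k\<in>insert x A. fps_const (1 / fact ((a(x := v)) k)) * f k ^ (a(x := v)) k)"
      using insert.hyps by simp
  qed
  also have "\<dots> = (\<Sum>a\<in>weighted_exps (insert x A) (\<lambda>_. 1) j. \<Prod>k\<in>insert x A. fps_const (1 / fact (a k)) * f k ^ a k)"
    using insert.hyps by (subst sum_weighted_exps_insert) (auto simp: atMost_def)
  finally show ?case .
qed

section \<open>Elementary symmetric functions and Waring's formula\<close>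

text \<open>Expand the product over subsets and group these by cardinality. The embedding
  \<open>h\<close> of constants lets one proof serve polynomials (\<open>z\<close> the variable,
  \<open>t = 1\<close>) and power series (\<open>z = 1\<close>, \<open>t\<close> the
  variable).\<close>

lemma prod_linear_eq_sum_elem_sym:
  fixes z t :: "'a::comm_ring_1" and h :: "complex \<Rightarrow> 'a"
  assumes h: "\<And>a b. h (a * b) = h a * h b" "h 1 = 1" "\<And>a b. h (a + b) = h a + h b" "h 0 = 0"
  shows "(\<Prod>i=1..n. z - h (y i) * t) = (\<Sum>k=0..n. (- 1) ^ k * h (elem_sym n y k) * t ^ k * z ^ (n - k))"
proof -
  have hprod: "h (prod f B) = (\<Prod>x\<in>B. h (f x))" for f and B :: "nat set"
    by (induction B rule: infinite_finite_induct) (auto simp: h)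
  have hsum: "h (sum f B) = (\<Sum>x\<in>B. h (f x))" for f and B :: "nat set set"
    by (induction B rule: infinite_finite_induct) (auto simp: h)
  have "(\<Prod>i=1..n. z - h (y i) * t) = (\<Prod>i=1..n. - (h (y i) * t) + z)"
    by simp
  also have "\<dots> = (\<Sum>A\<in>Pow {1..n}. (\<Prod>i\<in>A. - (h (y i) * t)) * z ^ card ({1..n} - A))"
    by (subst prod_add) auto
  also have "\<dots> = (\<Sum>A\<in>Pow {1..n}. (- 1) ^ card A * h (\<Prod>i\<in>A. y i) * t ^ card A * z ^ (n - card A))"
    by (intro sum.cong refl)
      (auto simp: prod_uminus hprod prod.distrib card_Diff_subset finite_subset mult_ac)
  also have "\<dots> = (\<Sum>k=0..n. \<Sum>A | A \<in> Pow {1..n} \<and> card A = k.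
      (- 1) ^ card A * h (\<Prod>i\<in>A. y i) * t ^ card A * z ^ (n - card A))"
    using card_mono[of "{1..n}"] by (intro sum.group[symmetric]) auto
  also have "\<dots> = (\<Sum>k=0..n. (- 1) ^ k * h (elem_sym n y k) * t ^ k * z ^ (n - k))"
    by (intro sum.cong refl) (auto simp: elem_sym_def hsum sum_distrib_left sum_distrib_right intro!: sum.cong)
  finally show ?thesis .
qed

lemma poly_vieta:
  "(\<Prod>i=1..n. [:- y i, 1:]) = (\<Sum>k=0..n. monom ((- 1) ^ k * elem_sym n y k) (n - k))"
proof -
  have "(\<Prod>i=1..n. [:- y i, 1:]) = (\<Prod>i=1..n. [:0, 1:] - [:y i:] * 1)"
    by simp
  also have "\<dots> = (\<Sum>k=0..n. (- 1) ^ k * [:elem_sym n y k:] * 1 ^ k * [:0, 1:] ^ (n - k))"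
    by (rule prod_linear_eq_sum_elem_sym) (auto simp: one_pCons)
  also have "\<dots> = (\<Sum>k=0..n. monom ((- 1) ^ k * elem_sym n y k) (n - k))"
  proof (intro sum.cong refl)
    fix k
    have "(- 1) ^ k * [:elem_sym n y k:] = [:(- 1) ^ k * elem_sym n y k:]"
      by (cases "even k") auto
    then show "(- 1) ^ k * [:elem_sym n y k:] * 1 ^ k * [:0, 1:] ^ (n - k)
        = monom ((- 1) ^ k * elem_sym n y k) (n - k)"
      by (simp add: monom_altdef)
  qed
  finally show ?thesis .
qed

lemma fps_vieta:
  "(\<Prod>i=1..n. 1 - fps_const (y i) * fps_X)
    = (\<Sum>k=0..n. fps_const ((- 1) ^ k * elem_sym n y k) * fps_X ^ k)"
proof -
  have "(\<Prod>i=1..n. 1 - fps_const (y i) * fps_X)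
      = (\<Sum>k=0..n. (- 1) ^ k * fps_const (elem_sym n y k) * fps_X ^ k * 1 ^ (n - k))"
    by (rule prod_linear_eq_sum_elem_sym) auto
  also have "\<dots> = (\<Sum>k=0..n. fps_const ((- 1) ^ k * elem_sym n y k) * fps_X ^ k)"
  proof (intro sum.cong refl)
    fix k
    have "(- 1) ^ k * fps_const (elem_sym n y k) = fps_const ((- 1) ^ k * elem_sym n y k)"
      by (cases "even k") auto
    then show "(- 1) ^ k * fps_const (elem_sym n y k) * fps_X ^ k * 1 ^ (n - k)
        = fps_const ((- 1) ^ k * elem_sym n y k) * fps_X ^ k" by simp
  qed
  finally show ?thesis .
qed

lemma elem_sym_0 [simp]: "elem_sym n y 0 = 1"
proof -
  have "{A. A \<subseteq> {1..n} \<and> card A = 0} = {{}}"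
    by (auto dest: finite_subset)
  then show ?thesis by (simp add: elem_sym_def)
qed

text \<open>Newton's identities as a logarithmic derivative without division: the series is the sum
  of the y_i / (1 - y_i X), which is -F'/F. Its coefficient at \<open>l\<close> is the power sum of
  exponent \<open>Suc l\<close>, a shift by one that persists below.\<close>

lemma fps_newton:
  fixes y :: "nat \<Rightarrow> complex"
  defines "F \<equiv> \<lambda>n. \<Prod>i=1..n. 1 - fps_const (y i) * fps_X"
  shows "F n * Abs_fps (\<lambda>l. \<Sum>i=1..n. y i ^ Suc l) = - fps_deriv (F n)"
proof (induction n)
  case 0
  then show ?case by (simp add: F_def fps_zero_def)
next
  case (Suc n)
  let ?G = "\<lambda>n. Abs_fps (\<lambda>l. \<Sum>i=1..n. y i ^ Suc l)"
  have F: "F (Suc n) = F n * (1 - fps_const (y (Suc n)) * fps_X)"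
    by (simp add: F_def)
  have G: "?G (Suc n) = ?G n + fps_const (y (Suc n)) * Abs_fps (\<lambda>l. y (Suc n) ^ l)"
    by (rule fps_ext) simp
  have geo: "(1 - fps_const c * fps_X) * Abs_fps (\<lambda>l. c ^ l) = 1" for c :: complex
  proof (rule fps_ext)
    fix l
    show "((1 - fps_const c * fps_X) * Abs_fps (\<lambda>l. c ^ l)) $ l = 1 $ l"
      by (cases l) (simp_all add: left_diff_distrib mult.assoc)
  qed
  have "F (Suc n) * ?G (Suc n) = (F n * ?G n) * (1 - fps_const (y (Suc n)) * fps_X)
      + F n * fps_const (y (Suc n)) * ((1 - fps_const (y (Suc n)) * fps_X) * Abs_fps (\<lambda>l. y (Suc n) ^ l))"
    unfolding F G by (simp add: algebra_simps)
  also have "\<dots> = - fps_deriv (F (Suc n))"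
    unfolding Suc.IH F geo by (simp add: algebra_simps)
  finally show ?case .
qed

text \<open>This is the expansion of -log(1 - u) as the sum of the u^j / j, cut off at j = l. The
  cut is harmless for the coefficient of X^l because \<open>u\<close> has no constant term.\<close>

lemma power_sum_fps:
  fixes u :: "complex fps" and y :: "nat \<Rightarrow> complex"
  assumes u: "(\<Prod>i=1..n. 1 - fps_const (y i) * fps_X) = 1 - u" and "l \<ge> 1"
  shows "(\<Sum>i=1..n. y i ^ l) = of_nat l * (\<Sum>j=1..l. u ^ j $ l / of_nat j)"
proof -
  have u0: "u $ 0 = 0"
  proof -
    have "(\<Prod>i\<in>B. 1 - fps_const (y i) * fps_X) $ 0 = 1" for B
      by (induction B rule: infinite_finite_induct) auto
    from this[of "{1..n}"] have "(\<Prod>i=1..n. 1 - fps_const (y i) * fps_X) $ 0 = 1" .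
    then show ?thesis unfolding u by simp
  qed
  define G where "G = Abs_fps (\<lambda>l. \<Sum>i=1..n. y i ^ Suc l)"
  have G: "(1 - u) * G = fps_deriv u"
    using fps_newton[of y n] unfolding u G_def by simp
  \<comment> \<open>The truncated logarithm: by the finite geometric sum, its derivative is that of
    -log(1 - u) up to a multiple of \<open>u ^ l\<close>.\<close>
  define S where "S = (\<Sum>j=1..l. fps_const (1 / of_nat j) * u ^ j)"
  have "fps_deriv S = fps_deriv u * (\<Sum>j<l. u ^ j)"
  proof -
    have "fps_deriv S = (\<Sum>j=1..l. fps_deriv u * u ^ (j - 1))"
      unfolding S_def fps_deriv_sum
    proof (intro sum.cong refl)
      fix j assume "j \<in> {1..l}"
      then have "fps_const (1 / of_nat j) * (fps_const (of_nat j :: complex)) = 1"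
        by simp
      then have "fps_const (1 / of_nat j) * (fps_const (of_nat j) * fps_deriv u * u ^ (j - 1))
          = fps_deriv u * u ^ (j - 1)"
        by (metis mult.assoc mult_1)
      then show "fps_deriv (fps_const (1 / of_nat j) * u ^ j) = fps_deriv u * u ^ (j - 1)"
        by (simp add: fps_deriv_power)
    qed
    also have "\<dots> = (\<Sum>j<l. fps_deriv u * u ^ j)"
      by (rule sum.reindex_bij_witness[of _ Suc "\<lambda>j. j - 1"]) auto
    finally show ?thesis by (simp add: sum_distrib_left)
  qed
  then have S: "(1 - u) * fps_deriv S = fps_deriv u * (1 - u ^ l)"
    by (simp add: one_diff_power_eq mult_ac)
  have "(1 - u) * (G - fps_deriv S) = fps_deriv u * u ^ l"
    using S by (simp add: G right_diff_distrib[of "1 - u"] right_diff_distrib[of "fps_deriv u" 1])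
  then have "inverse (1 - u) * ((1 - u) * (G - fps_deriv S)) = inverse (1 - u) * fps_deriv u * u ^ l"
    by (simp add: mult_ac)
  moreover have "inverse (1 - u) * (1 - u) = 1"
    by (rule inverse_mult_eq_1) (simp add: u0)
  ultimately have D: "G - fps_deriv S = inverse (1 - u) * fps_deriv u * u ^ l"
    by (metis mult.assoc mult_1)
  have v: "u = fps_X * fps_shift 1 u"
  proof (rule fps_ext)
    show "u $ k = (fps_X * fps_shift 1 u) $ k" for k
      using u0 by (cases k) auto
  qed
  \<comment> \<open>The error is a multiple of \<open>u ^ l\<close>, hence of X^l, and so cannot
    reach the coefficient at \<open>l - 1\<close>, where \<open>G\<close> holds the power sum of
    exponent \<open>l\<close>.\<close>
  have "(G - fps_deriv S) $ (l - 1) = 0"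
  proof -
    have "u ^ l = fps_X ^ l * fps_shift 1 u ^ l"
      by (subst v) (rule power_mult_distrib)
    then have "G - fps_deriv S = fps_X ^ l * (inverse (1 - u) * fps_deriv u * fps_shift 1 u ^ l)"
      unfolding D by (simp only: ac_simps)
    then show ?thesis using assms(2) by (simp add: fps_X_power_mult_nth)
  qed
  then have "G $ (l - 1) = of_nat l * S $ l"
    using assms(2) by simp
  moreover have "y i * y i ^ (l - Suc 0) = y i ^ l" for i
    using assms(2) by (simp flip: power_Suc)
  ultimately show ?thesis
    by (simp add: G_def S_def fps_sum_nth)
qed

lemma fps_const_prod: "(\<Prod>k\<in>A. fps_const (f k)) = fps_const (\<Prod>k\<in>A. f k)"
  by (induction A rule: infinite_finite_induct) auto

text \<open>Apply the logarithmic expansion to \<open>u\<close> and expand its powers by the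
  multinomial theorem. The bijection \<open>w\<close> leaves the labelling free: the identity serves
  \<open>t_poly\<close>, the reversal of \<open>{1..M}\<close> serves the nested sum.\<close>

lemma waring_power_sum:
  fixes y :: "nat \<Rightarrow> complex" and w :: "'i \<Rightarrow> nat"
  assumes w: "bij_betw w A {1..n}" and l: "l \<ge> 1"
  shows "(\<Sum>i=1..n. y i ^ l) = (\<Sum>a\<in>weighted_exps A w l.
     of_nat l * fact ((\<Sum>k\<in>A. a k) - 1) *
     (\<Prod>k\<in>A. (- ((- 1) ^ w k * elem_sym n y (w k))) ^ a k / fact (a k)))"
proof -
  define c where "c k = - ((- 1) ^ w k * elem_sym n y (w k))" for k
  define u where "u = (\<Sum>k\<in>A. fps_const (c k) * fps_X ^ w k)"
  have fin: "finite A" using w by (auto simp: bij_betw_finite)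
  have wpos: "w k > 0" if "k \<in> A" for k
    using bij_betwE[OF w] that by force
  have "(\<Prod>i=1..n. 1 - fps_const (y i) * fps_X)
      = 1 + (\<Sum>k=1..n. fps_const ((- 1) ^ k * elem_sym n y k) * fps_X ^ k)"
    unfolding fps_vieta by (simp add: sum.atLeast_Suc_atMost)
  also have "\<dots> = 1 - u"
  proof -
    have "fps_const (c k) * fps_X ^ w k = - (fps_const ((- 1) ^ w k * elem_sym n y (w k)) * fps_X ^ w k)" for k
      unfolding c_def fps_const_neg[symmetric] by (rule minus_mult_left[symmetric])
    then show ?thesis
      unfolding u_def sum.reindex_bij_betw[OF w, symmetric] by (simp only: sum_negf) simp
  qed
  finally have F: "(\<Prod>i=1..n. 1 - fps_const (y i) * fps_X) = 1 - u" .
  let ?t = "\<lambda>a. \<Prod>k\<in>A. c k ^ a k / fact (a k)"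
  \<comment> \<open>Total degree \<open>j\<close> comes from the power of \<open>u\<close>, weight
    \<open>l\<close> from the power of X that each monomial carries.\<close>
  have coeff: "u ^ j $ l = fact j * (\<Sum>a | a \<in> weighted_exps A w l \<and> (\<Sum>k\<in>A. a k) = j. ?t a)" for j
  proof -
    have fin': "finite (weighted_exps A (\<lambda>_. 1) j)"
      using fin by (intro finite_weighted_exps) auto
    have "(1 / fact j) * u ^ j $ l = (fps_const (1 / fact j) * u ^ j) $ l"
      by simp
    also have "\<dots> = (\<Sum>a\<in>weighted_exps A (\<lambda>_. 1) j. (\<Prod>k\<in>A. fps_const (1 / fact (a k)) * (fps_const (c k) * fps_X ^ w k) ^ a k) $ l)"
      unfolding u_def fps_multinomial[OF fin] fps_sum_nth ..
    also have "\<dots> = (\<Sum>a\<in>weighted_exps A (\<lambda>_. 1) j. if (\<Sum>k\<in>A. w k * a k) = l then ?t a else 0)"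
    proof (intro sum.cong refl)
      fix a
      have "(\<Prod>k\<in>A. fps_const (1 / fact (a k)) * (fps_const (c k) * fps_X ^ w k) ^ a k)
         = (\<Prod>k\<in>A. fps_const (c k ^ a k / fact (a k)) * fps_X ^ (w k * a k))"
        by (intro prod.cong refl) (simp add: power_mult_distrib power_mult fps_const_power mult.assoc[symmetric])
      also have "\<dots> = fps_const (?t a) * fps_X ^ (\<Sum>k\<in>A. w k * a k)"
        unfolding prod.distrib power_sum fps_const_prod ..
      finally show "(\<Prod>k\<in>A. fps_const (1 / fact (a k)) * (fps_const (c k) * fps_X ^ w k) ^ a k) $ l
         = (if (\<Sum>k\<in>A. w k * a k) = l then ?t a else 0)" by simp
    qed
    also have "\<dots> = (\<Sum>a | a \<in> weighted_exps A (\<lambda>_. 1) j \<and> (\<Sum>k\<in>A. w k * a k) = l. ?t a)"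
      using fin' by (simp add: sum.If_cases Int_def)
    also have "{a. a \<in> weighted_exps A (\<lambda>_. 1) j \<and> (\<Sum>k\<in>A. w k * a k) = l}
        = {a. a \<in> weighted_exps A w l \<and> (\<Sum>k\<in>A. a k) = j}"
      by (auto simp: weighted_exps_def)
    finally have eq: "1 / fact j * u ^ j $ l = (\<Sum>a | a \<in> weighted_exps A w l \<and> (\<Sum>k\<in>A. a k) = j. ?t a)" .
    show ?thesis unfolding eq[symmetric] by simp
  qed
  have finw: "finite (weighted_exps A w l)" using fin wpos by (rule finite_weighted_exps)
  \<comment> \<open>Weights are at least 1, which bounds the total degree by \<open>l\<close>, and
    \<open>l \<ge> 1\<close> excludes the zero vector. Hence grouping by the degrees
    \<open>1..l\<close> loses no vector.\<close>
  have range: "(\<Sum>k\<in>A. a k) \<in> {1..l}" if "a \<in> weighted_exps A w l" for a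
  proof -
    have eq: "(\<Sum>k\<in>A. w k * a k) = l" using that by (simp add: weighted_exps_def)
    have "(\<Sum>k\<in>A. a k) \<le> (\<Sum>k\<in>A. w k * a k)"
      using wpos by (intro sum_mono) (simp add: Suc_le_eq)
    moreover have "(\<Sum>k\<in>A. a k) \<noteq> 0"
    proof
      assume "(\<Sum>k\<in>A. a k) = 0"
      then have "(\<Sum>k\<in>A. w k * a k) = 0" using fin by simp
      then show False using eq l by simp
    qed
    ultimately show ?thesis using eq by simp
  qed
  have "(\<Sum>i=1..n. y i ^ l) = of_nat l * (\<Sum>j=1..l. u ^ j $ l / of_nat j)"
    by (rule power_sum_fps[OF F l])
  also have "(\<Sum>j=1..l. u ^ j $ l / of_nat j)
      = (\<Sum>j=1..l. \<Sum>a | a \<in> weighted_exps A w l \<and> (\<Sum>k\<in>A. a k) = j. fact ((\<Sum>k\<in>A. a k) - 1) * ?t a)"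
  proof (intro sum.cong refl)
    fix j assume "j \<in> {1..l}"
    then have "fact j / of_nat j = (fact (j - 1) :: complex)"
      by (simp add: fact_reduce[of j])
    then have "u ^ j $ l / of_nat j = fact (j - 1) * (\<Sum>a | a \<in> weighted_exps A w l \<and> (\<Sum>k\<in>A. a k) = j. ?t a)"
      unfolding coeff by (simp only: times_divide_eq_left[symmetric])
    then show "u ^ j $ l / of_nat j
        = (\<Sum>a | a \<in> weighted_exps A w l \<and> (\<Sum>k\<in>A. a k) = j. fact ((\<Sum>k\<in>A. a k) - 1) * ?t a)"
      by (simp add: sum_distrib_left)
  qed
  also have "\<dots> = (\<Sum>a\<in>weighted_exps A w l. fact ((\<Sum>k\<in>A. a k) - 1) * ?t a)"
    using finw range by (intro sum.group) auto
  finally show ?thesis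
    unfolding sum_distrib_left c_def by (simp only: mult.assoc)
qed

section \<open>Multivariate polynomials and existence and uniqueness of t_poly\<close>

lemma meval_eq_sum:
  assumes "finite K" "Poly_Mapping.keys p \<subseteq> K"
  shows "meval p s = (\<Sum>m\<in>K. Poly_Mapping.lookup p m *
      (\<Prod>v\<in>Poly_Mapping.keys m. s v ^ Poly_Mapping.lookup m v))"
  unfolding meval_def using assms
  by (intro sum.mono_neutral_left) (auto simp: in_keys_iff)

lemma meval_zero [simp]: "meval 0 s = 0"
  by (simp add: meval_def)

lemma meval_single:
  "meval (Poly_Mapping.single m c) s = c * (\<Prod>v\<in>Poly_Mapping.keys m. s v ^ Poly_Mapping.lookup m v)"
  by (subst meval_eq_sum[of "{m}"]) auto

lemma meval_add: "meval (p + q) s = meval p s + meval q s"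
proof -
  let ?K = "Poly_Mapping.keys p \<union> Poly_Mapping.keys q"
  have "Poly_Mapping.keys (p + q) \<subseteq> ?K" by (rule Poly_Mapping.keys_add)
  then show ?thesis
    by (simp add: meval_eq_sum[of ?K] lookup_add ring_distribs sum.distrib)
qed

lemma meval_diff: "meval (p - q) s = meval p s - meval q s"
proof -
  have "meval p s = meval (p - q) s + meval q s" by (simp add: meval_add[symmetric])
  then show ?thesis by simp
qed

lemma meval_sum: "meval (\<Sum>i\<in>I. f i) s = (\<Sum>i\<in>I. meval (f i) s)"
  by (induction I rule: infinite_finite_induct) (auto simp: meval_add)

lemma meval_cong:
  assumes "\<And>v. v \<in> mvars p \<Longrightarrow> s v = s' v"
  shows "meval p s = meval p s'"
  unfolding meval_def
  by (intro sum.cong prod.cong refl arg_cong2[of _ _ _ _ "(*)"]) (use assms in \<open>fastforce simp: mvars_def\<close>)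

text \<open>The lowest digit is the residue modulo \<open>D\<close>; cancelling it and dividing by
  \<open>D\<close> leaves the same problem with one digit fewer.\<close>

lemma base_digits_unique:
  assumes "\<And>v. v < n \<Longrightarrow> a v < (D::nat)" "\<And>v. v < n \<Longrightarrow> b v < D"
    and "(\<Sum>v<n. a v * D ^ v) = (\<Sum>v<n. b v * D ^ v)" and "v < n"
  shows "a v = b v"
  using assms
proof (induction n arbitrary: a b v)
  case (Suc n)
  have split: "(\<Sum>v<Suc n. f v * D ^ v) = f 0 + D * (\<Sum>v<n. f (Suc v) * D ^ v)" for f
    by (simp add: sum.lessThan_Suc_shift sum_distrib_left mult_ac del: sum.lessThan_Suc)
  have eq: "a 0 + D * (\<Sum>v<n. a (Suc v) * D ^ v) = b 0 + D * (\<Sum>v<n. b (Suc v) * D ^ v)"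
    using Suc.prems(3) unfolding split .
  have lt: "a 0 < D" "b 0 < D" using Suc.prems(1,2) by auto
  have a0: "a 0 = b 0"
    using arg_cong[OF eq, of "\<lambda>x. x mod D"] lt by simp
  then have "(\<Sum>v<n. a (Suc v) * D ^ v) = (\<Sum>v<n. b (Suc v) * D ^ v)"
    using eq lt by simp
  from Suc.IH[OF _ _ this] have "a (Suc v) = b (Suc v)" if "v < n" for v
    using that Suc.prems(1,2) by auto
  then show ?case using a0 Suc.prems(4) by (cases v) auto
qed simp

text \<open>Kronecker substitution: setting the \<open>v\<close>-th variable to \<open>z ^ D ^ v\<close> with \<open>D\<close> larger than
  all exponents sends distinct monomials to distinct powers of \<open>z\<close>.\<close>

lemma meval_eq_0_imp_eq_0:
  assumes "\<And>s. meval p s = 0"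
  shows "p = 0"
proof (rule ccontr)
  assume "p \<noteq> 0"
  then obtain m0 where m0: "m0 \<in> Poly_Mapping.keys p"
    using keys_eq_empty[of p] by blast
  let ?K = "Poly_Mapping.keys p"
  have "finite (\<Union>m\<in>?K. Poly_Mapping.keys m)" by simp
  then obtain n where n: "\<And>m v. m \<in> ?K \<Longrightarrow> v \<in> Poly_Mapping.keys m \<Longrightarrow> v < n"
    unfolding finite_nat_set_iff_bounded by blast
  have "finite (\<Union>m\<in>?K. Poly_Mapping.lookup m ` {..<n})" by simp
  then obtain D where D: "\<And>m v. m \<in> ?K \<Longrightarrow> v < n \<Longrightarrow> Poly_Mapping.lookup m v < D"
    unfolding finite_nat_set_iff_bounded by blast
  define E where "E m = (\<Sum>v<n. Poly_Mapping.lookup m v * D ^ v)" for m :: "nat \<Rightarrow>\<^sub>0 nat"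
  have inj: "m = m'" if "m \<in> ?K" "m' \<in> ?K" "E m = E m'" for m m'
  proof (rule poly_mapping_eqI)
    fix v
    show "Poly_Mapping.lookup m v = Poly_Mapping.lookup m' v"
    proof (cases "v < n")
      case True
      show ?thesis
        by (rule base_digits_unique[OF _ _ _ True, of _ D]) (use that D in \<open>auto simp: E_def\<close>)
    next
      case False
      then have "v \<notin> Poly_Mapping.keys m" "v \<notin> Poly_Mapping.keys m'" using n that by auto
      then show ?thesis by (simp add: in_keys_iff)
    qed
  qed
  define q where "q = (\<Sum>m\<in>?K. monom (Poly_Mapping.lookup p m) (E m))"
  have "poly q z = 0" for z
  proof -
    have "poly q z = (\<Sum>m\<in>?K. Poly_Mapping.lookup p m * z ^ E m)"
      by (simp add: q_def poly_sum poly_monom)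
    also have "\<dots> = meval p (\<lambda>v. z ^ (D ^ v))"
      unfolding meval_def
    proof (intro sum.cong refl arg_cong2[of _ _ _ _ "(*)"])
      fix m assume "m \<in> ?K"
      have "z ^ E m = (\<Prod>v<n. (z ^ (D ^ v)) ^ Poly_Mapping.lookup m v)"
        by (simp add: E_def power_sum power_mult[symmetric] mult.commute)
      also have "\<dots> = (\<Prod>v\<in>Poly_Mapping.keys m. (z ^ (D ^ v)) ^ Poly_Mapping.lookup m v)"
        using n[OF \<open>m \<in> ?K\<close>] by (intro prod.mono_neutral_right) (auto simp: in_keys_iff)
      finally show "z ^ E m = (\<Prod>v\<in>Poly_Mapping.keys m. (z ^ (D ^ v)) ^ Poly_Mapping.lookup m v)" .
    qed
    finally show ?thesis using assms by simp
  qed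
  then have "q = 0" using poly_all_0_iff_0[of q] by blast
  \<comment> \<open>Since \<open>E\<close> is injective on the monomials of \<open>p\<close>, only
    \<open>m0\<close> contributes to this coefficient.\<close>
  then have "0 = coeff q (E m0)" by simp
  also have "\<dots> = (\<Sum>m\<in>?K. if m = m0 then Poly_Mapping.lookup p m0 else 0)"
    unfolding q_def coeff_sum using inj m0 by (intro sum.cong) auto
  also have "\<dots> = Poly_Mapping.lookup p m0" using m0 by simp
  finally show False using m0 by (simp add: in_keys_iff)
qed

section \<open>Surjectivity of the elementary symmetric map and the polynomials t\<close>

lemma monic_factorization:
  fixes q :: "complex poly"
  assumes "degree q = n" "lead_coeff q = 1"
  obtains y :: "nat \<Rightarrow> complex" where "q = (\<Prod>i=1..n. [:- y i, 1:])"
proof -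
  from alg_closed_imp_factorization[of q] assms
  obtain A where A: "size A = n" "q = (\<Prod>x\<in>#A. [:-x, 1:])" by fastforce
  obtain xs where xs: "mset xs = A" using ex_mset by blast
  have len: "length xs = n" using A xs by auto
  have "q = (\<Prod>x\<leftarrow>xs. [:-x, 1:])"
    unfolding A(2) xs[symmetric] by (metis mset_map prod_mset_prod_list)
  also have "\<dots> = (\<Prod>i=0..<n. [:- (xs ! i), 1:])"
    by (simp add: prod.list_conv_set_nth len)
  also have "\<dots> = (\<Prod>i=1..n. [:- (xs ! (i - 1)), 1:])"
    by (rule prod.reindex_bij_witness[of _ "\<lambda>i. i - 1" Suc]) auto
  finally show thesis by (rule that)
qed

lemma coeff_sum_monom_diff:
  assumes "k \<le> n"
  shows "coeff (\<Sum>j=0..n. monom (c j) (n - j)) (n - k) = c k"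
proof -
  have "coeff (\<Sum>j=0..n. monom (c j) (n - j)) (n - k) = (\<Sum>j=0..n. if j = k then c k else 0)"
    unfolding coeff_sum using assms by (intro sum.cong) auto
  then show ?thesis using assms by simp
qed

text \<open>Take the monic polynomial whose coefficients are the prescribed values up to sign; the
  fundamental theorem of algebra supplies its roots \<open>y\<close>, and Vieta's formulas identify
  their symmetric functions.\<close>

lemma elem_sym_surj:
  obtains y where "\<And>k. k \<in> {1..n} \<Longrightarrow> elem_sym n y k = s k"
proof -
  \<comment> \<open>The value at index 0 is overridden by 1 to make the polynomial monic;
    \<open>s 0\<close> is arbitrary.\<close>
  define c where "c k = (- 1) ^ k * (if k = 0 then 1 else s k)" for k
  define q where "q = (\<Sum>k=0..n. monom (c k) (n - k))"
  have "degree q \<le> n"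
    unfolding q_def by (intro degree_sum_le) (auto intro: order_trans[OF degree_monom_le])
  moreover have "coeff q n = 1"
    using coeff_sum_monom_diff[of 0 n c] by (simp add: q_def c_def)
  ultimately have "degree q = n" "lead_coeff q = 1"
    using le_degree[of q n] by auto
  then obtain y where y: "q = (\<Prod>i=1..n. [:- y i, 1:])"
    by (rule monic_factorization)
  have "elem_sym n y k = s k" if "k \<in> {1..n}" for k
  proof -
    have "(- 1) ^ k * elem_sym n y k = c k"
      using coeff_sum_monom_diff[of k n c] coeff_sum_monom_diff[of k n "\<lambda>k. (- 1) ^ k * elem_sym n y k"]
        that y unfolding q_def poly_vieta by simp
    then show ?thesis using that by (simp add: c_def)
  qed
  then show thesis by (rule that)
qed

text \<open>Waring's formula is already polynomial in the elementary symmetric functions, so its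
  coefficients define the witness. It needs a positive exponent, hence the separate case
  \<open>r = 0\<close>, where the constant 1 works.\<close>

lemma t_poly_exists:
  assumes "n \<ge> 1"
  shows "\<exists>p. mvars p \<subseteq> {1..n} \<and> (\<forall>y. meval p (elem_sym n y) = power_mean n y r)"
proof (cases "r = 0")
  case True
  have "mvars (Poly_Mapping.single 0 1) \<subseteq> {1..n}" by (simp add: mvars_def)
  moreover have "meval (Poly_Mapping.single 0 1) (elem_sym n y) = power_mean n y r" for y
    using assms True by (simp add: meval_single power_mean_def del: single_one)
  ultimately show ?thesis by blast
next
  case False
  let ?C = "weighted_exps {1..n} (\<lambda>k. k) r"
  define m where "m a = Abs_poly_mapping a" for a :: "nat \<Rightarrow> nat"
  have m: "Poly_Mapping.lookup (m a) = a" "Poly_Mapping.keys (m a) \<subseteq> {1..n}" if "a \<in> ?C" for a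
  proof -
    have *: "{k. a k \<noteq> 0} \<subseteq> {1..n}" using that by (auto simp: weighted_exps_def)
    show l: "Poly_Mapping.lookup (m a) = a"
      unfolding m_def using finite_subset[OF *] by (simp add: Abs_poly_mapping_inverse)
    show "Poly_Mapping.keys (m a) \<subseteq> {1..n}"
      using * by (auto simp: in_keys_iff l)
  qed
  \<comment> \<open>The coefficient of the monomial \<open>m a\<close> in Waring's formula, signs
    included, divided by \<open>n\<close> to pass from a sum to a mean.\<close>
  define c :: "(nat \<Rightarrow> nat) \<Rightarrow> complex" where "c a = 1 / of_nat n * (of_nat r * fact ((\<Sum>k=1..n. a k) - 1) *
     (\<Prod>k=1..n. (- ((- 1) ^ k)) ^ a k / fact (a k)))" for a
  define p where "p = (\<Sum>a\<in>?C. Poly_Mapping.single (m a) (c a))"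
  have "mvars p \<subseteq> {1..n}"
  proof -
    have "Poly_Mapping.keys p \<subseteq> m ` ?C"
      using keys_sum[of "\<lambda>a. Poly_Mapping.single (m a) (c a)" ?C] by (auto simp: p_def split: if_splits)
    then show ?thesis using m(2) by (fastforce simp: mvars_def)
  qed
  moreover have "meval p (elem_sym n y) = power_mean n y r" for y
  proof -
    let ?e = "elem_sym n y"
    have "meval p ?e = (\<Sum>a\<in>?C. c a * (\<Prod>k=1..n. ?e k ^ a k))"
      unfolding p_def meval_sum meval_single
    proof (intro sum.cong refl arg_cong2[of _ _ _ _ "(*)"])
      fix a assume a: "a \<in> ?C"
      show "(\<Prod>v\<in>Poly_Mapping.keys (m a). ?e v ^ Poly_Mapping.lookup (m a) v) = (\<Prod>k=1..n. ?e k ^ a k)"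
        unfolding m(1)[OF a] using m(2)[OF a]
        by (intro prod.mono_neutral_left) (auto simp: in_keys_iff m(1)[OF a])
    qed
    also have "\<dots> = 1 / of_nat n * (\<Sum>a\<in>?C. of_nat r * fact ((\<Sum>k=1..n. a k) - 1) *
       (\<Prod>k=1..n. (- ((- 1) ^ k * ?e k)) ^ a k / fact (a k)))"
      unfolding sum_distrib_left
    proof (intro sum.cong refl)
      fix a :: "nat \<Rightarrow> nat"
      have "(\<Prod>k=1..n. (- ((- 1) ^ k * ?e k)) ^ a k / fact (a k))
        = (\<Prod>k=1..n. (- ((- 1) ^ k)) ^ a k / fact (a k)) * (\<Prod>k=1..n. ?e k ^ a k)"
        unfolding prod.distrib[symmetric]
        by (intro prod.cong refl) (simp only: times_divide_eq_left power_mult_distrib[symmetric] minus_mult_left)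
      then show "c a * (\<Prod>k=1..n. ?e k ^ a k) = 1 / of_nat n * (of_nat r * fact ((\<Sum>k=1..n. a k) - 1) *
         (\<Prod>k=1..n. (- ((- 1) ^ k * ?e k)) ^ a k / fact (a k)))"
        by (simp add: c_def)
    qed
    also have "\<dots> = power_mean n y r"
      unfolding power_mean_def using False by (subst waring_power_sum[of "\<lambda>k. k" "{1..n}"]) (auto simp: bij_betw_def)
    finally show ?thesis .
  qed
  ultimately show ?thesis by blast
qed

text \<open>The definite description is legitimate: two candidates agree at all vectors of
  elementary symmetric functions. These fill every choice of the variables \<open>1..n\<close>, and
  no other variable occurs, so the difference vanishes everywhere and is zero.\<close>

lemma t_poly:
  assumes "n \<ge> 1"
  shows "mvars (t_poly n r) \<subseteq> {1..n}" "meval (t_poly n r) (elem_sym n y) = power_mean n y r"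
proof -
  have "\<exists>!p. mvars p \<subseteq> {1..n} \<and> (\<forall>y. meval p (elem_sym n y) = power_mean n y r)"
  proof (rule ex_ex1I[OF t_poly_exists[OF assms]], clarify)
    fix p q
    assume p: "mvars p \<subseteq> {1..n}" "\<forall>y. meval p (elem_sym n y) = power_mean n y r"
      and q: "mvars q \<subseteq> {1..n}" "\<forall>y. meval q (elem_sym n y) = power_mean n y r"
    have "meval (p - q) s = 0" for s
    proof -
      obtain y where y: "\<And>k. k \<in> {1..n} \<Longrightarrow> elem_sym n y k = s k"
        using elem_sym_surj[of n s] by blast
      have "meval p (elem_sym n y) = meval p s" "meval q (elem_sym n y) = meval q s"
        using y p(1) q(1) by (auto intro!: meval_cong)
      then show ?thesis using p(2) q(2) by (simp add: meval_diff)
    qed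
    then have "p - q = 0" by (rule meval_eq_0_imp_eq_0)
    then show "p = q" by simp
  qed
  from theI'[OF this] show "mvars (t_poly n r) \<subseteq> {1..n}" "meval (t_poly n r) (elem_sym n y) = power_mean n y r"
    unfolding t_poly_def by auto
qed

text \<open>Only coordinates in \<open>{1..n}\<close> are seen, so \<open>s\<close> need not match
  the symmetric functions at other indices.\<close>

lemma meval_t_poly:
  assumes "n \<ge> 1" "\<And>k. k \<in> {1..n} \<Longrightarrow> elem_sym n y k = s k"
  shows "meval (t_poly n r) s = power_mean n y r"
proof -
  have "meval (t_poly n r) s = meval (t_poly n r) (elem_sym n y)"
    using t_poly(1)[OF assms(1), of r] assms(2) by (intro meval_cong) (simp add: subset_iff)
  then show ?thesis by (simp only: t_poly(2)[OF assms(1)])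
qed

text \<open>Homogeneity of degree \<open>k\<close>; together with its analogue for power means it
  handles the rescaled points -y_j and -y_j / \<omega>.\<close>

lemma elem_sym_scale: "elem_sym n (\<lambda>i. c * y i) k = c ^ k * elem_sym n y k"
  unfolding elem_sym_def sum_distrib_left
  by (intro sum.cong refl) (auto simp: prod.distrib finite_subset)

lemma power_mean_scale: "power_mean n (\<lambda>i. c * y i) r = c ^ r * power_mean n y r"
  by (simp add: power_mean_def power_mult_distrib sum_distrib_left mult_ac)

section \<open>The nested sum\<close>

text \<open>The bound for the k-th index says exactly that the weight of the first k indices is
  still at most \<open>l\<close>. As weights are nonnegative, the last bound implies the earlier
  ones. The condition \<open>n < M\<close> keeps the denominators positive.\<close>

lemma nested_sum_eq_sum:
  assumes "n < M"
  shows "nested_sum n (B_bound M l) f = sum f (\<Union>l'\<le>l. weighted_exps {1..n} (\<lambda>k. M + 1 - k) l')"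
  using assms
proof (induction n arbitrary: f)
  case 0
  then show ?case by (simp add: weighted_exps_empty)
next
  case (Suc n)
  define w where "w k = M + 1 - k" for k :: nat
  define S where "S n = (\<Union>l'\<le>l. weighted_exps {1..n} w l')" for n
  have S_iff: "i \<in> S n \<longleftrightarrow> (\<forall>k. k \<notin> {1..n} \<longrightarrow> i k = 0) \<and> (\<Sum>k=1..n. w k * i k) \<le> l" for i n
    by (auto simp: S_def weighted_exps_def)
  have w_pos: "w (Suc n) > 0" using Suc.prems by (simp add: w_def)
  have fin: "finite (S n)"
    unfolding S_def using Suc.prems by (auto intro!: finite_weighted_exps simp: w_def)
  define V where "V i = {v. int v \<le> \<lfloor>B_bound M l (Suc n) i\<rfloor>}" for i
  \<comment> \<open>Clearing the positive denominator turns the bound by a floor of a real quotient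
    into an inequality between natural numbers.\<close>
  have V: "v \<in> V i \<longleftrightarrow> (\<Sum>k=1..n. w k * i k) + w (Suc n) * v \<le> l" for v i
  proof -
    have "real (\<Sum>k=1..n. w k * i k) = (\<Sum>j=1..n. (real M + 1 - real j) * real (i j))"
      unfolding of_nat_sum using Suc.prems by (intro sum.cong) (auto simp: w_def of_nat_diff)
    moreover have "real (w (Suc n)) = real M - real n"
      using Suc.prems by (simp add: w_def of_nat_diff)
    ultimately have B: "B_bound M l (Suc n) i = (real l - real (\<Sum>k=1..n. w k * i k)) / real (w (Suc n))"
      by (simp add: B_bound_def)
    have "v \<in> V i \<longleftrightarrow> real v \<le> B_bound M l (Suc n) i"
      by (simp add: V_def le_floor_iff)
    also have "\<dots> \<longleftrightarrow> real v * real (w (Suc n)) \<le> real l - real (\<Sum>k=1..n. w k * i k)"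
      unfolding B using w_pos by (subst pos_le_divide_eq) auto
    also have "\<dots> \<longleftrightarrow> real ((\<Sum>k=1..n. w k * i k) + w (Suc n) * v) \<le> real l"
      by (simp only: of_nat_add of_nat_mult) (simp add: mult.commute le_diff_eq add.commute)
    finally show ?thesis unfolding of_nat_le_iff .
  qed
  have finV: "finite (V i)" for i
    by (rule finite_subset[OF _ finite_mult_le[OF w_pos, of l]]) (auto simp: V)
  have upd: "(\<Sum>k=1..n. w k * (i(Suc n := v)) k) = (\<Sum>k=1..n. w k * i k)" for i v
    by (rule sum_weight_upd) simp
  have "nested_sum (Suc n) (B_bound M l) f = (\<Sum>i\<in>S n. \<Sum>v\<in>V i. f (i(Suc n := v)))"
    using Suc.prems by (simp add: Suc.IH S_def V_def w_def[abs_def])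
  also have "\<dots> = (\<Sum>(i, v)\<in>Sigma (S n) V. f (i(Suc n := v)))"
    using fin finV by (subst sum.Sigma) auto
  also have "\<dots> = (\<Sum>i\<in>S (Suc n). f i)"
  proof (rule sum.reindex_bij_witness[of _ "\<lambda>i. (i(Suc n := 0), i (Suc n))" "\<lambda>(i, v). i(Suc n := v)"])
    fix p assume "p \<in> Sigma (S n) V"
    then obtain i v where p: "p = (i, v)" "i \<in> S n" "v \<in> V i" by auto
    have "i (Suc n) = 0" using p(2) by (simp add: S_iff)
    then show "(\<lambda>i. (i(Suc n := 0), i (Suc n))) ((\<lambda>(i, v). i(Suc n := v)) p) = p"
      by (simp add: p(1) fun_upd_idem)
    show "(case p of (i, v) \<Rightarrow> i(Suc n := v)) \<in> S (Suc n)"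
      using p(2,3) upd[of i v] unfolding S_iff V p(1) by auto
    show "f (case p of (i, v) \<Rightarrow> i(Suc n := v)) = (case p of (i, v) \<Rightarrow> f (i(Suc n := v)))"
      by (simp add: p(1))
  next
    fix i assume i: "i \<in> S (Suc n)"
    then show "(\<lambda>i. (i(Suc n := 0), i (Suc n))) i \<in> Sigma (S n) V"
      using upd[of i 0] unfolding S_iff by (auto simp: V S_iff)
  qed auto
  finally show ?case by (simp add: S_def w_def[abs_def])
qed

text \<open>The index \<open>M\<close> has weight 1, so its exponent is the slack that the other
  indices leave. Weight exactly \<open>l\<close> in \<open>M\<close> variables thus becomes weight
  at most \<open>l\<close> in \<open>M - 1\<close> variables.\<close>

lemma sum_weighted_exps_last:
  assumes "M \<ge> 1"
  shows "(\<Sum>a\<in>weighted_exps {1..M} (\<lambda>k. M + 1 - k) l. g a) =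
    (\<Sum>i\<in>(\<Union>l'\<le>l. weighted_exps {1..M - 1} (\<lambda>k. M + 1 - k) l').
      g (i(M := l - (\<Sum>k=1..M - 1. (M + 1 - k) * i k))))"
proof -
  define w where "w k = M + 1 - k" for k :: nat
  have ins: "{1..M} = insert M {1..M - 1}" using assms by auto
  have sum: "(\<Sum>k=1..M. w k * a k) = a M + (\<Sum>k=1..M - 1. w k * a k)" for a
    unfolding ins using assms by (subst sum.insert) (auto simp: w_def)
  have upd: "(\<Sum>k=1..M - 1. w k * (i(M := v)) k) = (\<Sum>k=1..M - 1. w k * i k)" for i v
    using assms by (intro sum_weight_upd) auto
  have "(\<Sum>a\<in>weighted_exps {1..M} w l. g a) = (\<Sum>i\<in>(\<Union>l'\<le>l. weighted_exps {1..M - 1} w l').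
      g (i(M := l - (\<Sum>k=1..M - 1. w k * i k))))"
  proof (rule sum.reindex_bij_witness[of _ "\<lambda>i. i(M := l - (\<Sum>k=1..M - 1. w k * i k))" "\<lambda>a. a(M := 0)"])
    fix a assume a: "a \<in> weighted_exps {1..M} w l"
    then have l: "l - (\<Sum>k=1..M - 1. w k * a k) = a M" "(\<Sum>k=1..M - 1. w k * a k) \<le> l"
      using sum[of a] by (auto simp: weighted_exps_def)
    then show "(a(M := 0))(M := l - (\<Sum>k=1..M - 1. w k * (a(M := 0)) k)) = a"
      unfolding upd by simp
    then show "g ((a(M := 0))(M := l - (\<Sum>k=1..M - 1. w k * (a(M := 0)) k))) = g a"
      by (rule arg_cong)
    show "a(M := 0) \<in> (\<Union>l'\<le>l. weighted_exps {1..M - 1} w l')"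
      using a l(2) upd[of a 0] unfolding weighted_exps_def by auto
  next
    fix i assume i: "i \<in> (\<Union>l'\<le>l. weighted_exps {1..M - 1} w l')"
    then have "i M = 0" "(\<Sum>k=1..M - 1. w k * i k) \<le> l" "\<And>k. k \<notin> {1..M} \<Longrightarrow> i k = 0"
      using assms by (auto simp: weighted_exps_def)
    then show "(i(M := l - (\<Sum>k=1..M - 1. w k * i k)))(M := 0) = i"
      "i(M := l - (\<Sum>k=1..M - 1. w k * i k)) \<in> weighted_exps {1..M} w l"
      using assms unfolding weighted_exps_def mem_Collect_eq sum upd by (auto simp: fun_upd_idem)
  qed
  then show ?thesis by (simp add: w_def[abs_def])
qed

text \<open>Waring's formula with the labelling reversed: index \<open>k\<close> belongs to
  \<open>\<sigma> (2 * (M + 1 - k))\<close>, and the slack exponent at index \<open>M\<close>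
  becomes the exponent of \<open>\<sigma> 2\<close>.\<close>

lemma power_sum_nested:
  fixes y :: "nat \<Rightarrow> complex" and \<sigma> :: "nat \<Rightarrow> complex"
  assumes M: "M \<ge> 1" and l: "l \<ge> 1"
    and y: "\<And>k. k \<in> {1..M} \<Longrightarrow> elem_sym M y k = (- 1) ^ k * \<sigma> (2 * k)"
  shows "(\<Sum>i=1..M. y i ^ l) = (- 1) ^ l * nested_sum (M - 1) (B_bound M l)
              (\<lambda>i. (\<Prod>k=1..M - 1. (-1) ^ ((M - k) * i k) / fact (i k))
                * bracket M l i
                * (\<sigma> 2 ^ sigma2_exp M l i * (\<Prod>p=2..M. \<sigma> (2 * p) ^ i (M - p + 1))))"
proof -
  define w where "w k = M + 1 - k" for k :: nat
  have bij: "bij_betw w {1..M} {1..M}"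
    by (rule bij_betwI[of _ _ _ w]) (auto simp: w_def)
  have ins: "{1..M} = insert M {1..M - 1}" and wM: "w M = 1" using M by (auto simp: w_def)
  \<comment> \<open>The alternating sign in Waring's formula cancels the one in the hypothesis on
    \<open>y\<close>.\<close>
  have neg: "- ((- 1) ^ w k * elem_sym M y (w k)) = - \<sigma> (2 * w k)" if "k \<in> {1..M}" for k
  proof -
    have "w k \<in> {1..M}" using that bij_betwE[OF bij] by blast
    then show ?thesis by (simp add: y mult.assoc[symmetric] power_mult_distrib[symmetric])
  qed
  have "(\<Sum>i=1..M. y i ^ l) = (\<Sum>a\<in>weighted_exps {1..M} w l. of_nat l * fact ((\<Sum>k=1..M. a k) - 1) *
     (\<Prod>k=1..M. (- \<sigma> (2 * w k)) ^ a k / fact (a k)))"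
    unfolding waring_power_sum[OF bij l] using neg by (intro sum.cong refl arg_cong2[of _ _ _ _ "(*)"] prod.cong) auto
  also have "\<dots> = (\<Sum>i\<in>(\<Union>l'\<le>l. weighted_exps {1..M - 1} w l').
     let a = i(M := l - (\<Sum>k=1..M - 1. w k * i k)) in of_nat l * fact ((\<Sum>k=1..M. a k) - 1) *
       (\<Prod>k=1..M. (- \<sigma> (2 * w k)) ^ a k / fact (a k)))"
    using sum_weighted_exps_last[OF M] unfolding w_def[abs_def] Let_def .
  also have "\<dots> = (\<Sum>i\<in>(\<Union>l'\<le>l. weighted_exps {1..M - 1} w l'). (- 1) ^ l * (
                (\<Prod>k=1..M - 1. (-1) ^ ((M - k) * i k) / fact (i k))
                * bracket M l i
                * (\<sigma> 2 ^ sigma2_exp M l i * (\<Prod>p=2..M. \<sigma> (2 * p) ^ i (M - p + 1)))))"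
  proof (intro sum.cong refl)
    fix i assume i: "i \<in> (\<Union>l'\<le>l. weighted_exps {1..M - 1} w l')"
    define W where "W = (\<Sum>k=1..M - 1. w k * i k)"
    define W' where "W' = (\<Sum>k=1..M - 1. (M - k) * i k)"
    define I where "I = (\<Sum>k=1..M - 1. i k)"
    define E where "E = l - W"
    define a where "a = i(M := E)"
    have W: "W \<le> l" using i by (auto simp: weighted_exps_def W_def)
    \<comment> \<open>Each weight is \<open>(M - k) + 1\<close>. Hence the total degree
      \<open>E + I\<close> equals \<open>l - W'\<close>, which yields the factorial in the numerator
      of \<open>bracket\<close>.\<close>
    have WW: "W = W' + I"
      unfolding W_def W'_def I_def sum.distrib[symmetric] using M
      by (intro sum.cong) (auto simp: w_def Suc_diff_le)
    have a: "a M = E" "\<And>k. k \<in> {1..M - 1} \<Longrightarrow> a k = i k"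
      using M by (auto simp: a_def)
    have ins_prod: "prod g {1..M} = g M * prod g {1..M - 1}" for g :: "nat \<Rightarrow> complex"
      unfolding ins using M by (subst prod.insert) auto
    have "(\<Sum>k=1..M. a k) = E + (\<Sum>k=1..M - 1. a k)"
      unfolding ins using M by (subst sum.insert) (auto simp: a(1))
    also have "(\<Sum>k=1..M - 1. a k) = I"
      unfolding I_def using a(2) by (intro sum.cong) auto
    finally have f1: "(\<Sum>k=1..M. a k) - 1 = l - 1 - W'"
      using W WW by (simp add: E_def)
    have f2: "(\<Prod>k=1..M. (- \<sigma> (2 * w k)) ^ a k / fact (a k))
        = (- \<sigma> 2) ^ E / fact E * (\<Prod>k=1..M - 1. (- \<sigma> (2 * w k)) ^ i k / fact (i k))"
      unfolding ins_prod a(1) wM using a(2)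
      by (intro arg_cong2[of _ _ _ _ "(*)"] prod.cong) auto
    have f3: "(\<Prod>k=1..M - 1. (- \<sigma> (2 * w k)) ^ i k / fact (i k))
        = (- 1) ^ I * (\<Prod>k=1..M - 1. 1 / fact (i k)) * (\<Prod>k=1..M - 1. \<sigma> (2 * w k) ^ i k)"
      unfolding I_def power_sum prod.distrib[symmetric]
      by (intro prod.cong refl) (simp add: power_minus[of "\<sigma> _"])
    \<comment> \<open>The reversal \<open>w\<close> is its own inverse and exchanges
      \<open>{1..M - 1}\<close> with \<open>{2..M}\<close>.\<close>
    have f4: "(\<Prod>k=1..M - 1. \<sigma> (2 * w k) ^ i k) = (\<Prod>p=2..M. \<sigma> (2 * p) ^ i (M - p + 1))"
      by (rule prod.reindex_bij_witness[of _ w w]) (use M in \<open>auto simp: w_def Suc_diff_le\<close>)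
    have f5: "(\<Prod>k=1..M - 1. (-1) ^ ((M - k) * i k) / fact (i k))
        = (- 1) ^ W' * (\<Prod>k=1..M - 1. 1 / fact (i k) :: complex)"
      unfolding W'_def power_sum prod.distrib[symmetric] by simp
    have f6: "(- 1) ^ E * (- 1) ^ I = ((- 1) ^ l * (- 1) ^ W' :: complex)"
    proof -
      have "E + I + W' = l" using W WW by (simp add: E_def)
      then have "(- 1) ^ l = (- 1) ^ E * (- 1) ^ I * ((- 1) ^ W' :: complex)"
        by (simp add: power_add[symmetric])
      then have "(- 1) ^ l * (- 1) ^ W' = (- 1) ^ E * (- 1) ^ I * ((- 1) ^ W' * (- 1) ^ W' :: complex)"
        by (simp only: mult.assoc)
      then show ?thesis by (simp add: power_mult_distrib[symmetric])
    qed
    have f7: "bracket M l i = of_nat l * fact (l - 1 - W') / fact E"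
      unfolding bracket_def W'_def E_def W_def w_def ..
    have f8: "sigma2_exp M l i = E"
      unfolding sigma2_exp_def E_def W_def w_def ..
    have f9: "(- \<sigma> 2) ^ E = (- 1) ^ E * \<sigma> 2 ^ E"
      by (rule power_minus)
    \<comment> \<open>With \<open>inverse D\<close> treated as an atom this is a ring identity
      modulo the sign relation, so \<open>D\<close> need not be shown nonzero.\<close>
    have alg: "L * F * (A * T / D * (B * Q * R)) = C * (W * Q * (L * F / D) * (T * R))"
      if "A * B = C * W" for A B C D F L Q R T W :: complex
      using that unfolding divide_inverse by algebra
    show "(let a = i(M := l - (\<Sum>k=1..M - 1. w k * i k)) in of_nat l * fact ((\<Sum>k=1..M. a k) - 1) *
       (\<Prod>k=1..M. (- \<sigma> (2 * w k)) ^ a k / fact (a k))) = (- 1) ^ l * (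
                (\<Prod>k=1..M - 1. (-1) ^ ((M - k) * i k) / fact (i k))
                * bracket M l i
                * (\<sigma> 2 ^ sigma2_exp M l i * (\<Prod>p=2..M. \<sigma> (2 * p) ^ i (M - p + 1))))"
      unfolding Let_def W_def[symmetric] E_def[symmetric] a_def[symmetric]
        f1 f2 f3 f4 f5 f7 f8 f9
      by (rule alg[OF f6])
  qed
  also have "\<dots> = (- 1) ^ l * nested_sum (M - 1) (B_bound M l)
              (\<lambda>i. (\<Prod>k=1..M - 1. (-1) ^ ((M - k) * i k) / fact (i k))
                * bracket M l i
                * (\<sigma> 2 ^ sigma2_exp M l i * (\<Prod>p=2..M. \<sigma> (2 * p) ^ i (M - p + 1))))"
    unfolding sum_distrib_left[symmetric] w_def[abs_def] using M by (subst nested_sum_eq_sum) auto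
  finally show ?thesis .
qed

section \<open>Polynomials of definite parity\<close>

lemma proots_prod_linear:
  "proots (\<Prod>i\<in>A. [:- f i, 1:]) = image_mset f (mset_set A)"
  for f :: "'b \<Rightarrow> 'a::idom"
  by (subst proots_prod) (auto, induction A rule: infinite_finite_induct, auto)

text \<open>Parity removes the coefficients of odd index, so P(t) is t^(N mod 2) times a polynomial
  in t^2. Its zeros are therefore the pairs of square roots \<open>z j\<close>,
  \<open>- z j\<close>, and one extra 0 when \<open>N\<close> is odd. The term \<open>0 ^ r\<close>
  is 1 for \<open>r = 0\<close>, so this zero is counted there as well.\<close>

lemma definite_parity_roots:
  fixes x :: "nat \<Rightarrow> complex" and N :: nat
  defines "P \<equiv> \<Prod>i=1..N. [:- x i, 1:]"
  assumes parity: "\<And>t. poly P (- t) = (- 1) ^ N * poly P t"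
  obtains z where "\<And>k. k \<in> {1..N div 2} \<Longrightarrow>
      elem_sym (N div 2) (\<lambda>j. z j ^ 2) k = (- 1) ^ k * elem_sym N x (2 * k)"
    and "\<And>r. (\<Sum>i=1..N. x i ^ r) =
      (\<Sum>j=1..N div 2. z j ^ r + (- z j) ^ r) + of_nat (N mod 2) * 0 ^ r"
proof -
  define M where "M = N div 2"
  let ?e = "elem_sym N x"
  have P: "P = (\<Sum>k=0..N. monom ((- 1) ^ k * ?e k) (N - k))"
    unfolding P_def by (rule poly_vieta)
  have odd0: "?e k = 0" if "odd k" "k \<le> N" for k
  proof -
    \<comment> \<open>Comparing coefficients of P(-t) and (-1)^N P(t) at \<open>N - k\<close> gives
      opposite signs when \<open>k\<close> is odd.\<close>
    have "pcompose P [:0, - 1:] = smult ((- 1) ^ N) P"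
      by (rule poly_ext) (simp add: poly_pcompose parity)
    then have "coeff (pcompose P [:0, - 1:]) (N - k) = (- 1) ^ N * coeff P (N - k)"
      by simp
    then have "(- 1) ^ (N - k) * coeff P (N - k) = (- 1) ^ N * coeff P (N - k)"
      by (simp add: coeff_pcompose_linear)
    moreover have "(- 1) ^ (N - k) = (- ((- 1) ^ N) :: complex)"
      using that by (cases "even N") auto
    ultimately have "coeff P (N - k) = 0" by (cases "even N") auto
    then show ?thesis
      unfolding P coeff_sum_monom_diff[OF that(2)] by simp
  qed
  \<comment> \<open>The signs are chosen so that the product of the s - y_j has the even-indexed
    values \<open>?e (2 * k)\<close> as coefficients.\<close>
  obtain y where y: "\<And>k. k \<in> {1..M} \<Longrightarrow> elem_sym M y k = (- 1) ^ k * ?e (2 * k)"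
    using elem_sym_surj[of M "\<lambda>k. (- 1) ^ k * ?e (2 * k)"] by blast
  \<comment> \<open>The branch is immaterial, since both square roots enter as zeros.\<close>
  define z where "z j = csqrt (y j)" for j
  have zy: "z j ^ 2 = y j" for j by (simp add: z_def)
  \<comment> \<open>Factors are kept in the shape \<open>[:- c, 1:]\<close>, from which the multiset
    of zeros is read off; this is why \<open>minus_minus\<close> is withheld from the simplifier
    below.\<close>
  have "P = [:- 0, 1:] ^ (N mod 2) * ((\<Prod>j=1..M. [:- z j, 1:]) * (\<Prod>j=1..M. [:- (- z j), 1:]))" (is "_ = ?R")
  proof (rule poly_ext)
    fix t
    have "poly P t = (\<Sum>k=0..N. (- 1) ^ k * ?e k * t ^ (N - k))"
      unfolding P by (simp add: poly_sum poly_monom)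
    also have "\<dots> = (\<Sum>k\<in>(\<lambda>j. 2 * j) ` {0..M}. (- 1) ^ k * ?e k * t ^ (N - k))"
    proof (rule sum.mono_neutral_right)
      show "\<forall>k\<in>{0..N} - (\<lambda>j. 2 * j) ` {0..M}. (- 1) ^ k * ?e k * t ^ (N - k) = 0"
      proof
        fix k assume k: "k \<in> {0..N} - (\<lambda>j. 2 * j) ` {0..M}"
        have "odd k"
        proof
          assume "even k"
          then have "k = 2 * (k div 2)" "k div 2 \<in> {0..M}" using k by (auto simp: M_def div_le_mono)
          then show False using k by blast
        qed
        then show "(- 1) ^ k * ?e k * t ^ (N - k) = 0" using k odd0 by simp
      qed
    qed (auto simp: M_def)
    also have "\<dots> = (\<Sum>j=0..M. ?e (2 * j) * t ^ (N - 2 * j))"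
      by (subst sum.reindex) (auto simp: inj_on_def)
    also have "\<dots> = t ^ (N mod 2) * (\<Sum>j=0..M. (- 1) ^ j * elem_sym M y j * (t\<^sup>2) ^ (M - j))"
      unfolding sum_distrib_left
    proof (intro sum.cong refl)
      fix j assume j: "j \<in> {0..M}"
      then have "N - 2 * j = N mod 2 + 2 * (M - j)"
        unfolding M_def by presburger
      then have "t ^ (N - 2 * j) = t ^ (N mod 2) * (t\<^sup>2) ^ (M - j)"
        by (simp add: power_add power_mult)
      moreover have "(- 1) ^ j * elem_sym M y j = ?e (2 * j)"
        using j y[of j] by (cases "j = 0") (auto simp: mult.assoc[symmetric] power_mult_distrib[symmetric])
      ultimately show "?e (2 * j) * t ^ (N - 2 * j)
          = t ^ (N mod 2) * ((- 1) ^ j * elem_sym M y j * (t\<^sup>2) ^ (M - j))"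
        by (simp only: ac_simps)
    qed
    also have "(\<Sum>j=0..M. (- 1) ^ j * elem_sym M y j * (t\<^sup>2) ^ (M - j)) = poly (\<Prod>j=1..M. [:- y j, 1:]) (t\<^sup>2)"
      unfolding poly_vieta by (simp add: poly_sum poly_monom)
    also have "\<dots> = (\<Prod>j=1..M. (t - z j) * (t + z j))"
      by (simp add: poly_prod zy[symmetric] power2_eq_square algebra_simps)
    also have "t ^ (N mod 2) * \<dots> = poly ?R t"
      by (simp add: poly_prod prod.distrib poly_power add.commute[of t])
    finally show "poly P t = poly ?R t" .
  qed
  moreover have repeat_mset_singleton: "repeat_mset n {#a#} = replicate_mset n a" for n and a :: complex
    by (rule multiset_eqI) simp
  ultimately have "proots P = replicate_mset (N mod 2) 0
      + (image_mset z (mset_set {1..M}) + image_mset (\<lambda>j. - z j) (mset_set {1..M}))"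
    by (simp add: proots_mult proots_power proots_prod_linear repeat_mset_singleton del: minus_minus)
  \<comment> \<open>Equality as multisets respects multiplicities, so it transfers to all power
    sums.\<close>
  then have roots: "image_mset x (mset_set {1..N}) = replicate_mset (N mod 2) 0
      + (image_mset z (mset_set {1..M}) + image_mset (\<lambda>j. - z j) (mset_set {1..M}))"
    unfolding P_def proots_prod_linear .
  have "(\<Sum>i=1..N. x i ^ r) = (\<Sum>j=1..M. z j ^ r + (- z j) ^ r) + of_nat (N mod 2) * 0 ^ r" for r
  proof -
    have "(\<Sum>i=1..N. x i ^ r) = \<Sum>\<^sub># (image_mset (\<lambda>t. t ^ r) (image_mset x (mset_set {1..N})))"
      by (simp add: sum_unfold_sum_mset image_mset.compositionality comp_def)
    also have "\<dots> = of_nat (N mod 2) * 0 ^ r + ((\<Sum>j=1..M. z j ^ r) + (\<Sum>j=1..M. (- z j) ^ r))"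
      unfolding roots by (simp add: sum_unfold_sum_mset image_mset.compositionality comp_def)
    finally show ?thesis by (simp add: sum.distrib)
  qed
  then show thesis using y by (intro that[of z]) (simp_all add: M_def zy)
qed

section \<open>The moments of the zeros: assembly of the four assertions\<close>

theorem mainTheorem1:
  fixes N M :: nat
    and P :: "complex poly"
    and x :: "nat \<Rightarrow> complex"
    and \<sigma> m :: "nat \<Rightarrow> complex"
  assumes N: "N \<ge> 1"
    and sigma: "\<And>k. \<sigma> k = elem_sym N x k"
    and P_coeffs: "P = (\<Sum>k=0..N. monom ((-1) ^ k * \<sigma> k) (N - k))"
    and P_zeros: "P = (\<Prod>i=1..N. [:- x i, 1:])"
    and parity: "\<And>z. poly P (- z) = (-1) ^ N * poly P z"
    and m: "\<And>r. m r = power_mean N x r"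
    and M: "M = N div 2"
  shows "m 0 = 1
    \<and> (\<forall>l. m (2 * l + 1) = 0)
    \<and> (N \<ge> 4 \<longrightarrow> (\<forall>l\<ge>1.
          m (2 * l) = 2 / of_nat N * (-1) ^ l *
            nested_sum (M - 1) (B_bound M l)
              (\<lambda>i. (\<Prod>k=1..M - 1. (-1) ^ ((M - k) * i k) / fact (i k))
                * bracket M l i
                * (\<sigma> 2 ^ sigma2_exp M l i * (\<Prod>p=2..M. \<sigma> (2 * p) ^ i (M - p + 1))))
        \<and> m (2 * l) = 2 / of_nat N * of_nat M * (-1) ^ l * meval (t_poly M l) (\<lambda>k. \<sigma> (2 * k))
        \<and> (\<sigma> (2 * M) \<noteq> 0 \<longrightarrow> (\<forall>\<omega>. \<omega> ^ M = \<sigma> (2 * M) \<longrightarrow>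
              m (2 * l) = 2 / of_nat N * of_nat M * (-1) ^ l * \<omega> ^ l
                * cheb_T (M - 1) l (\<lambda>k. \<sigma> (2 * k) / \<omega> ^ k)))))
    \<and> (\<forall>l\<ge>1. (N = 1 \<longrightarrow> m (2 * l) = 0)
        \<and> (N = 2 \<longrightarrow> m (2 * l) = (- \<sigma> 2) ^ l)
        \<and> (N = 3 \<longrightarrow> m (2 * l) = 2 / 3 * (- \<sigma> 2) ^ l))"
proof -
  obtain z where e: "\<And>k. k \<in> {1..M} \<Longrightarrow> elem_sym M (\<lambda>j. z j ^ 2) k = (- 1) ^ k * \<sigma> (2 * k)"
    and ps: "\<And>r. (\<Sum>i=1..N. x i ^ r) = (\<Sum>j=1..M. z j ^ r + (- z j) ^ r) + of_nat (N mod 2) * 0 ^ r"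
    using definite_parity_roots[OF parity[unfolded P_zeros]] unfolding sigma M by blast
  define y where "y j = z j ^ 2" for j
  have y: "elem_sym M y k = (- 1) ^ k * \<sigma> (2 * k)" if "k \<in> {1..M}" for k
    using e[OF that] by (simp add: y_def[abs_def])
  have even: "m (2 * l) = 2 / of_nat N * (\<Sum>j=1..M. y j ^ l)" if "l \<ge> 1" for l
  proof -
    have "(\<Sum>i=1..N. x i ^ (2 * l)) = 2 * (\<Sum>j=1..M. y j ^ l)"
      unfolding ps using that by (simp add: y_def power_mult sum_distrib_left)
    then show ?thesis by (simp add: m power_mean_def)
  qed
  have m0: "m 0 = 1" using N by (simp add: m power_mean_def)
  have odd: "m (2 * l + 1) = 0" for l
    unfolding m power_mean_def ps by simp
  \<comment> \<open>For \<open>N = 2\<close> and \<open>N = 3\<close> there is a single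
    \<open>y 1\<close>, determined by its first symmetric function; for \<open>N = 1\<close> the sum
    over the \<open>y j\<close> is empty.\<close>
  have y1: "y 1 = - \<sigma> 2" if "M = 1"
  proof -
    have "{A. A \<subseteq> {1..1::nat} \<and> card A = 1} = {{1}}"
      by (auto simp: subset_singleton_iff)
    then show ?thesis using y[of 1] that by (simp add: elem_sym_def)
  qed
  have means: "m (2 * l) = 2 / of_nat N * of_nat M * power_mean M y l" if "l \<ge> 1" "M \<ge> 1" for l
    using that by (simp add: even power_mean_def)
  have t: "m (2 * l) = 2 / of_nat N * of_nat M * (-1) ^ l * meval (t_poly M l) (\<lambda>k. \<sigma> (2 * k))"
    if "l \<ge> 1" "M \<ge> 1" for l
  proof -
    \<comment> \<open>Negating the points multiplies the k-th symmetric function by (-1)^k, which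
      leaves exactly \<open>\<sigma> (2 * k)\<close>.\<close>
    have "meval (t_poly M l) (\<lambda>k. \<sigma> (2 * k)) = power_mean M (\<lambda>j. - 1 * y j) l"
      using that by (intro meval_t_poly) (auto simp only: elem_sym_scale y mult.assoc[symmetric] power_mult_distrib[symmetric], auto)
    also have "\<dots> = (- 1) ^ l * power_mean M y l"
      by (rule power_mean_scale)
    finally show ?thesis
      using that by (simp add: means mult.assoc[symmetric] power_mult_distrib[symmetric])
  qed
  have T: "m (2 * l) = 2 / of_nat N * of_nat M * (-1) ^ l * \<omega> ^ l * cheb_T (M - 1) l (\<lambda>k. \<sigma> (2 * k) / \<omega> ^ k)"
    if "l \<ge> 1" "M \<ge> 1" "\<sigma> (2 * M) \<noteq> 0" "\<omega> ^ M = \<sigma> (2 * M)" for l \<omega>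
  proof -
    have \<omega>: "\<omega> \<noteq> 0" using that by (auto simp: power_0_left split: if_splits)
    have "cheb_T (M - 1) l (\<lambda>k. \<sigma> (2 * k) / \<omega> ^ k)
        = meval (t_poly M l) ((\<lambda>k. \<sigma> (2 * k) / \<omega> ^ k)(M := 1))"
      using that by (simp add: cheb_T_def)
    \<comment> \<open>At these points the k-th symmetric function is
      \<open>\<sigma> (2 * k) / \<omega> ^ k\<close>. For \<open>k = M\<close> it equals 1 by the
      choice of \<open>\<omega>\<close>, as the last argument of the Chebyshev polynomial
      requires.\<close>
    also have "\<dots> = power_mean M (\<lambda>j. (- 1 / \<omega>) * y j) l"
    proof (intro meval_t_poly)
      fix k assume k: "k \<in> {1..M}"
      have "elem_sym M (\<lambda>j. (- 1 / \<omega>) * y j) k = ((- 1 / \<omega>) * (- 1)) ^ k * \<sigma> (2 * k)"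
        unfolding elem_sym_scale y[OF k] power_mult_distrib by (simp only: mult.assoc)
      also have "\<dots> = \<sigma> (2 * k) / \<omega> ^ k" by (simp add: power_divide)
      finally show "elem_sym M (\<lambda>j. (- 1 / \<omega>) * y j) k = ((\<lambda>k. \<sigma> (2 * k) / \<omega> ^ k)(M := 1)) k"
        using that by auto
    qed (use that in auto)
    also have "\<dots> = (- 1 / \<omega>) ^ l * power_mean M y l"
      by (rule power_mean_scale)
    finally have "(-1) ^ l * \<omega> ^ l * cheb_T (M - 1) l (\<lambda>k. \<sigma> (2 * k) / \<omega> ^ k)
        = ((- 1) * \<omega> * (- 1 / \<omega>)) ^ l * power_mean M y l"
      by (simp only: power_mult_distrib mult.assoc)
    also have "\<dots> = power_mean M y l" using \<omega> by simp
    finally show ?thesis unfolding means[OF that(1,2)] by (simp only: mult.assoc)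
  qed
  have nested: "m (2 * l) = 2 / of_nat N * (-1) ^ l *
            nested_sum (M - 1) (B_bound M l)
              (\<lambda>i. (\<Prod>k=1..M - 1. (-1) ^ ((M - k) * i k) / fact (i k))
                * bracket M l i
                * (\<sigma> 2 ^ sigma2_exp M l i * (\<Prod>p=2..M. \<sigma> (2 * p) ^ i (M - p + 1))))"
    if "l \<ge> 1" "M \<ge> 1" for l
    using power_sum_nested[of M l y \<sigma>, OF that(2,1) y] unfolding even[OF that(1)] by (simp only: mult.assoc)
  have M1: "M \<ge> 1" if "N \<ge> 4" using that M by simp
  have "(N = 1 \<longrightarrow> m (2 * l) = 0) \<and> (N = 2 \<longrightarrow> m (2 * l) = (- \<sigma> 2) ^ l)
      \<and> (N = 3 \<longrightarrow> m (2 * l) = 2 / 3 * (- \<sigma> 2) ^ l)" if "l \<ge> 1" for l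
    using even[OF that] y1 M by auto
  then show ?thesis using m0 odd nested t T M1 by blast
qed

end
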